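(* Let $\delta$ be the umbra with generating function $f(\delta,z)=1+z^2/2$, and for nonnegative integers $k$ and $t\ge0$ let $Q_k(x,t)=E[(x-t\mathbf{.}\beta\mathbf{.}\delta)^k]$. Then for all nonnegative integers $k$ $$Q_k(x,t)=H_k^{(t)}(x),$$ where $H_k^{(s^2)}(x)$ are the generalized Hermite polynomials, with generating function $\sum_{k\ge0}H_k^{(s^2)}(x)\frac{z^k}{k!}=\exp\{xz-s^2\frac{z^2}{2}\}$.
   Context: An umbra $\gamma$ is a symbol representing a sequence $g_0=1,g_1,g_2,\ldots$ of real numbers through a linear evaluation functional $E$ with $E[\gamma^n]=g_n$ (the $n$-th moment); $E$ is linear over $\mathbb{R}[x]$ and $E[1]=1$. The generating function of $\gamma$ is the formal power series $f(\gamma,z)=\sum_{n\ge0}g_nz^n/n!$. For $t\in\mathbb{R}$, $t\mathbf{.}\beta\mathbf{.}\gamma$ ($\beta$ the Bell umbra, whose moments are the Bell numbers) is the auxiliary umbra with generating function $\exp[t(f(\gamma,z)-1)]$, i.e. $E[(t\mathbf{.}\beta\mathbf{.}\gamma)^i]=\sum_{m=1}^i t^mB_{i,m}(g_1,\ldots,g_{i-m+1})$ for $i\ge1$, with $B_{i,m}$ the partial exponential Bell polynomials. $x-t\mathbf{.}\beta\mathbf{.}\gamma$ means $x+(-t)\mathbf{.}\beta\mathbf{.}\gamma$; its powers are expanded by the binomial theorem and evaluated linearly with $E$. (The umbra $t\mathbf{.}\beta\mathbf{.}\delta$, with generating function $\exp(tz^2/2)$, is the umbral counterpart of standard Brownian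 motion.) *)

theory Defs
  imports "HOL-Computational_Algebra.Computational_Algebra"
begin

text \<open>An umbra is represented by its sequence of moments.\<close>

typedef umbra = "{g :: nat \<Rightarrow> real. g 0 = 1}"
  morphisms moment Abs_umbra
  by (rule exI[of _ "\<lambda>_. 1"]) simp

lemma moment_0 [simp]: "moment \<gamma> 0 = 1"
  using moment[of \<gamma>] by simp

definition gf :: "umbra \<Rightarrow> real fps" where
  "gf \<gamma> = Abs_fps (\<lambda>n. moment \<gamma> n / fact n)"

definition umbra_of_gf :: "real fps \<Rightarrow> umbra" where
  "umbra_of_gf F = Abs_umbra (\<lambda>n. fact n * fps_nth F n)"

text \<open>Only series with constant term 1 are generating functions of umbrae; for the others
  \<^const>\<open>umbra_of_gf\<close> is unspecified.\<close>

lemma gf_umbra_of_gf: "fps_nth F 0 = 1 \<Longrightarrow> gf (umbra_of_gf F) = F"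
  by (simp add: gf_def umbra_of_gf_def Abs_umbra_inverse fps_eq_iff)

lemma umbra_of_gf_gf: "umbra_of_gf (gf \<gamma>) = \<gamma>"
  by (simp add: gf_def umbra_of_gf_def moment_inverse)

text \<open>The \<open>\<real>[x]\<close>-linear evaluation \<open>E : \<real>[x][\<gamma>] \<rightarrow> \<real>[x]\<close> with \<open>E[\<gamma>^n] = g_n\<close>. The outer
  polynomial variable stands for the umbra, the inner one for \<open>x\<close>.\<close>

definition umbral_eval :: "umbra \<Rightarrow> real poly poly \<Rightarrow> real poly" where
  "umbral_eval \<gamma> p = (\<Sum>n\<le>degree p. coeff p n * [:moment \<gamma> n:])"

lemma umbral_eval_bound:
  "degree p \<le> N \<Longrightarrow> umbral_eval \<gamma> p = (\<Sum>n\<le>N. coeff p n * [:moment \<gamma> n:])"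
  unfolding umbral_eval_def by (rule sum.mono_neutral_left) (auto simp: coeff_eq_0)

lemma umbral_eval_monom: "umbral_eval \<gamma> (monom c n) = c * [:moment \<gamma> n:]"
proof -
  have "umbral_eval \<gamma> (monom c n) = (\<Sum>i\<le>n. coeff (monom c n) i * [:moment \<gamma> i:])"
    by (intro umbral_eval_bound degree_monom_le)
  also have "\<dots> = (\<Sum>i\<in>{n}. coeff (monom c n) i * [:moment \<gamma> i:])"
    by (rule sum.mono_neutral_right) auto
  finally show ?thesis by simp
qed

lemma umbral_eval_one: "umbral_eval \<gamma> 1 = 1"
  by (simp add: umbral_eval_def one_pCons)

lemma umbral_eval_add: "umbral_eval \<gamma> (p + q) = umbral_eval \<gamma> p + umbral_eval \<gamma> q"
proof -
  define N where "N = max (degree p) (degree q)"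
  have "degree (p + q) \<le> N" "degree p \<le> N" "degree q \<le> N"
    by (auto simp: N_def intro: degree_add_le)
  then show ?thesis
    by (simp add: umbral_eval_bound[of _ N] sum.distrib distrib_right del: mult_pCons_right)
qed

lemma umbral_eval_smult: "umbral_eval \<gamma> (smult c p) = c * umbral_eval \<gamma> p"
  using umbral_eval_bound[OF degree_smult_le[of c p], of \<gamma>]
  by (simp add: umbral_eval_def sum_distrib_left mult.assoc del: mult_pCons_right)

text \<open>The auxiliary umbra \<open>t.\<beta>.\<gamma>\<close>, with generating function \<open>exp[t(f(\<gamma>,z) - 1)]\<close>.\<close>

definition dot_Bell_dot :: "real \<Rightarrow> umbra \<Rightarrow> umbra" where
  "dot_Bell_dot t \<gamma> = umbra_of_gf (fps_exp 1 oo (fps_const t * (gf \<gamma> - 1)))"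

lemma gf_dot_Bell_dot:
  "gf (dot_Bell_dot t \<gamma>) = fps_exp 1 oo (fps_const t * (gf \<gamma> - 1))"
  unfolding dot_Bell_dot_def by (rule gf_umbra_of_gf) simp

definition umbra_delta :: umbra where
  "umbra_delta = umbra_of_gf (1 + fps_const (1/2) * fps_X ^ 2)"

lemma gf_umbra_delta: "gf umbra_delta = 1 + fps_const (1/2) * fps_X ^ 2"
  unfolding umbra_delta_def by (rule gf_umbra_of_gf) simp

text \<open>\<open>Q k t\<close> is the polynomial \<open>Q_k(x,t)\<close> in \<open>x\<close>. Here \<open>[:[:0, 1:], 1:]\<close> is \<open>x + \<alpha>\<close>, with the
  umbra \<open>\<alpha> = (-t).\<beta>.\<delta>\<close>; this is how \<open>x - t.\<beta>.\<delta>\<close> is to be read.\<close>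

definition Q :: "nat \<Rightarrow> real \<Rightarrow> real poly" where
  "Q k t = umbral_eval (dot_Bell_dot (- t) umbra_delta) ([:[:0, 1:], 1:] ^ k)"

text \<open>The exponential series over \<open>\<real>[x]\<close>; \<^const>\<open>fps_exp\<close> needs coefficients in a field.\<close>

definition poly_fps_exp :: "real poly fps" where
  "poly_fps_exp = Abs_fps (\<lambda>n. [:1 / fact n:])"

text \<open>The generalized Hermite polynomials \<open>H_k^(v)(x)\<close>, where the superscript \<open>v\<close> is \<open>s\<^sup>2\<close> in the
  generating function \<open>exp(xz - s\<^sup>2 z\<^sup>2/2)\<close>.\<close>

definition gen_Hermite_gf :: "real \<Rightarrow> real poly fps" where
  "gen_Hermite_gf v =
     poly_fps_exp oo (fps_const [:0, 1:] * fps_X - fps_const [:v / 2:] * fps_X ^ 2)"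

definition gen_Hermite :: "nat \<Rightarrow> real \<Rightarrow> real poly" where
  "gen_Hermite k v = smult (fact k) (fps_nth (gen_Hermite_gf v) k)"

lemma gen_Hermite_generating_function:
  "Abs_fps (\<lambda>k. smult (1 / fact k) (gen_Hermite k v)) = gen_Hermite_gf v"
  by (simp add: gen_Hermite_def fps_eq_iff)

end

theory Submission
  imports Defs
begin

text \<open>Both \<open>\<Sum>\<^sub>k Q\<^sub>k(x,t) z\<^sup>k/k!\<close> and \<open>exp(xz - tz\<^sup>2/2)\<close> have constant term 1 and solve
  \<open>F' = (x - tz) F\<close>, a differential equation with a unique solution over \<open>\<real>[x]\<close>.\<close>

text \<open>The coefficient of z^m in the equation expresses (m+1) F_{m+1} through F_0, ..., F_m
  only, and m+1 can be cancelled in a domain of characteristic 0.\<close>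

lemma fps_linear_ODE_unique:
  fixes F G h :: "'a::{idom, ring_char_0} fps"
  assumes "fps_deriv F = h * F" "fps_deriv G = h * G" "fps_nth F 0 = fps_nth G 0"
  shows "F = G"
proof -
  have "fps_nth F n = fps_nth G n" for n
  proof (induction n rule: less_induct)
    case (less n)
    show ?case
    proof (cases n)
      case 0
      then show ?thesis using assms(3) by simp
    next
      case (Suc m)
      have "of_nat n * fps_nth F n = fps_nth (h * F) m"
        using arg_cong[OF assms(1), of "\<lambda>f. fps_nth f m"] Suc by simp
      also have "\<dots> = fps_nth (h * G) m"
        using less Suc by (auto simp: fps_mult_nth intro!: sum.cong)
      also have "\<dots> = of_nat n * fps_nth G n"
        using arg_cong[OF assms(2), of "\<lambda>f. fps_nth f m"] Suc by simp
      finally show ?thesis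
        using Suc by (simp del: of_nat_Suc)
    qed
  qed
  then show ?thesis by (simp add: fps_eq_iff)
qed

lemma of_nat_Suc_div_fact_Suc: "of_nat (Suc n) / fact (Suc n) = (1 / fact n :: real)"
  by (simp add: divide_simps)

lemma fps_deriv_poly_fps_exp: "fps_deriv poly_fps_exp = poly_fps_exp"
  by (simp add: fps_eq_iff poly_fps_exp_def of_nat_poly of_nat_Suc_div_fact_Suc
      del: of_nat_Suc fact_Suc)

lemma gen_Hermite_gf_ODE:
  "fps_deriv (gen_Hermite_gf v) =
     (fps_const [:0, 1:] - fps_const [:v:] * fps_X) * gen_Hermite_gf v"
proof -
  let ?g = "fps_const [:0, 1:] * fps_X - fps_const [:v / 2:] * fps_X ^ 2 :: real poly fps"
  have "fps_deriv ?g = fps_const [:0, 1:] - fps_const [:v:] * fps_X"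
    by (simp add: power2_eq_square fps_eq_iff numeral_fps_const numeral_poly)
  \<comment> \<open>The chain rule \<open>fps_compose_deriv\<close> requires the inner series to
    have no constant term.\<close>
  moreover have "fps_nth ?g 0 = 0"
    by simp
  ultimately show ?thesis
    unfolding gen_Hermite_gf_def
    by (simp add: fps_compose_deriv fps_deriv_poly_fps_exp mult.commute)
qed

text \<open>The exponent is t z^2/2, so the chain rule contributes the factor t z. The main proof
  uses this with -t in place of t.\<close>

lemma gf_dot_Bell_dot_delta_ODE:
  "fps_deriv (gf (dot_Bell_dot t umbra_delta)) =
     fps_const t * fps_X * gf (dot_Bell_dot t umbra_delta)"
proof -
  let ?g = "fps_const t * (gf umbra_delta - 1)"
  have "fps_deriv ?g = fps_const t * fps_X"
    by (simp add: gf_umbra_delta power2_eq_square fps_eq_iff numeral_fps_const)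
  moreover have "fps_nth ?g 0 = 0"
    by (simp add: gf_umbra_delta)
  ultimately show ?thesis
    unfolding gf_dot_Bell_dot
    by (simp add: fps_compose_deriv mult.commute)
qed

lemma umbral_eval_sum: "umbral_eval \<gamma> (sum p A) = (\<Sum>i\<in>A. umbral_eval \<gamma> (p i))"
proof (induction A rule: infinite_finite_induct)
  case (insert x A)
  then show ?case by (simp add: umbral_eval_add)
qed (simp_all add: umbral_eval_def)

text \<open>The outer variable \<open>monom 1 1\<close> is the umbra and \<open>c\<close> is a
  scalar for the evaluation, so the binomial theorem can be evaluated term by term.\<close>

lemma umbral_eval_binomial:
  "umbral_eval \<gamma> ([:c, 1:] ^ k) =
     (\<Sum>i\<le>k. of_nat (k choose i) * [:moment \<gamma> i:] * c ^ (k - i))"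
proof -
  have "[:c, 1:] = monom 1 1 + [:c:]"
    by (simp add: monom_altdef)
  then have "[:c, 1:] ^ k = (\<Sum>i\<le>k. monom (of_nat (k choose i) * c ^ (k - i)) i)"
    by (simp add: binomial_ring monom_power poly_const_pow of_nat_poly smult_monom mult_ac)
  then show ?thesis
    by (simp add: umbral_eval_sum umbral_eval_monom mult_ac del: mult_pCons_right mult_pCons_left)
qed

theorem proposition4p9:
  fixes t :: real and k :: nat
  assumes "t \<ge> 0"
  shows "Q k t = gen_Hermite k t"
proof -
  define \<alpha> where "\<alpha> = dot_Bell_dot (- t) umbra_delta"
  \<comment> \<open>\<open>A\<close> is exp(xz), and \<open>B\<close> is the generating function of
    \<alpha> with its real coefficients read as constant polynomials in x.\<close>
  define A :: "real poly fps" where "A = Abs_fps (\<lambda>n. smult (1 / fact n) ([:0, 1:] ^ n))"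
  define B where "B = Abs_fps (\<lambda>n. [:fps_nth (gf \<alpha>) n:])"
  have A: "fps_deriv A = fps_const [:0, 1:] * A"
    by (simp add: A_def fps_eq_iff of_nat_poly of_nat_Suc_div_fact_Suc del: of_nat_Suc fact_Suc)
  have B: "fps_deriv B = - (fps_const [:t:] * fps_X * B)"
  proof (rule fps_ext)
    fix n
    \<comment> \<open>The equation over the reals carries over to \<open>B\<close> coefficient by
      coefficient.\<close>
    have "fps_nth (fps_deriv (gf \<alpha>)) n = fps_nth (fps_const (- t) * (fps_X * gf \<alpha>)) n"
      unfolding \<alpha>_def gf_dot_Bell_dot_delta_ODE by (simp add: mult.assoc)
    then show "fps_nth (fps_deriv B) n = fps_nth (- (fps_const [:t:] * fps_X * B)) n"
      by (simp add: B_def of_nat_poly mult.assoc mult.commute[of _ "1 + real n"] split: if_splits)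
  qed
  have "A * B = gen_Hermite_gf t"
  proof (rule fps_linear_ODE_unique)
    \<comment> \<open>By the product rule the factors x and -tz of the two equations add up.\<close>
    show "fps_deriv (A * B) = (fps_const [:0, 1:] - fps_const [:t:] * fps_X) * (A * B)"
      unfolding fps_deriv_mult A B by (simp add: algebra_simps)
    show "fps_nth (A * B) 0 = fps_nth (gen_Hermite_gf t) 0"
      by (simp add: A_def B_def gf_def gen_Hermite_gf_def poly_fps_exp_def)
  qed (rule gen_Hermite_gf_ODE)
  moreover have "Q k t = smult (fact k) (fps_nth (B * A) k)"
  proof -
    \<comment> \<open>Writing the binomial coefficient as k!/(i! (k-i)!) turns the binomial sum into
      a Cauchy product; \<open>B\<close> comes first because i is the exponent of the umbra.\<close>
    have "of_nat (k choose i) * [:moment \<alpha> i:] * [:0, 1:] ^ (k - i) =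
        [:fact k:] * (fps_nth B i * fps_nth A (k - i))" if "i \<le> k" for i
      using that
      by (simp add: A_def B_def gf_def binomial_fact of_nat_poly mult.commute)
    then have "Q k t = [:fact k:] * fps_nth (B * A) k"
      unfolding Q_def umbral_eval_binomial fps_mult_nth sum_distrib_left \<alpha>_def[symmetric] atLeast0AtMost
      by (intro sum.cong) auto
    then show ?thesis by simp
  qed
  ultimately show ?thesis
    by (simp add: gen_Hermite_def mult.commute)
qed

end
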